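(* Let $k\ge 1$ and $m\ge 1$ be integers. For any tree $T$ of order $m$, every $k$-edge-connected cograph $G$ with $\delta(G)\ge k+m-1$ contains a subtree $T'\cong T$ such that $G-E(T')$ is $k$-edge-connected.
   Context: Graphs are finite, simple and undirected. The order of a graph is its number of vertices; $\delta(G)$ is the minimum degree. Cographs are defined recursively: $K_1$ is a cograph; the disjoint union of cographs is a cograph; the join of cographs is a cograph, where the join $G_1+G_2$ of vertex-disjoint graphs is obtained from their disjoint union by adding all edges between $V(G_1)$ and $V(G_2)$. (Equivalently, cographs are the graphs with no induced path $P_4$ on four vertices.) The edge-connectivity $\lambda(G)$ is the minimum number of edges whose removal from $G$ results in a disconnected graph or a trivial graph (a graph of order 1); in particular $\lambda(K_1)=0$. $G$ is $k$-edge-connected if $\lambda(G)\ge k$, with the additional convention that $K_1$ is regarded as 1-edge-connected. For $F\subseteq E(G)$, $G-F$ is the graph obtained by deleting all edges of $F$ (keeping all vertices). A subtree of $G$ is a (not necessarily induced) subgraph that is a tree. *)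

theory Defs
  imports Main
begin

datatype 'a graph = Graph (verts: "'a set") (edges: "'a set set")

definition simple_graph :: "'a graph \<Rightarrow> bool" where
  "simple_graph G \<longleftrightarrow> finite (verts G) \<and> verts G \<noteq> {} \<and>
     (\<forall>e \<in> edges G. e \<subseteq> verts G \<and> card e = 2)"

abbreviation adjacent :: "'a graph \<Rightarrow> 'a \<Rightarrow> 'a \<Rightarrow> bool" where
  "adjacent G u v \<equiv> {u, v} \<in> edges G"

definition degree :: "'a graph \<Rightarrow> 'a \<Rightarrow> nat" where
  "degree G v = card {u \<in> verts G. adjacent G v u}"

definition min_degree :: "'a graph \<Rightarrow> nat" where
  "min_degree G = Min (degree G ` verts G)"

definition subgraph :: "'a graph \<Rightarrow> 'a graph \<Rightarrow> bool" where
  "subgraph H G \<longleftrightarrow> simple_graph H \<and> verts H \<subseteq> verts G \<and> edges H \<subseteq> edges G"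

definition delete_edges :: "'a graph \<Rightarrow> 'a set set \<Rightarrow> 'a graph" where
  "delete_edges G F = Graph (verts G) (edges G - F)"

definition graph_isomorphic :: "'a graph \<Rightarrow> 'b graph \<Rightarrow> bool" where
  "graph_isomorphic G H \<longleftrightarrow> (\<exists>f. bij_betw f (verts G) (verts H) \<and>
     (\<forall>u \<in> verts G. \<forall>v \<in> verts G. adjacent G u v \<longleftrightarrow> adjacent H (f u) (f v)))"

definition connected_graph :: "'a graph \<Rightarrow> bool" where
  "connected_graph G \<longleftrightarrow> verts G \<noteq> {} \<and>
     (\<forall>u \<in> verts G. \<forall>v \<in> verts G. (adjacent G)\<^sup>*\<^sup>* u v)"

text \<open>A cycle is given by its vertices in cyclic order; the closing edge is the
  one obtained for the last index.\<close>

definition is_cycle :: "'a graph \<Rightarrow> 'a list \<Rightarrow> bool" where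
  "is_cycle G c \<longleftrightarrow> length c \<ge> 3 \<and> distinct c \<and> set c \<subseteq> verts G \<and>
     (\<forall>i < length c. adjacent G (c ! i) (c ! (Suc i mod length c)))"

definition is_tree :: "'a graph \<Rightarrow> bool" where
  "is_tree T \<longleftrightarrow> simple_graph T \<and> connected_graph T \<and> (\<nexists>c. is_cycle T c)"

definition disjoint_union :: "'a graph \<Rightarrow> 'a graph \<Rightarrow> 'a graph" where
  "disjoint_union G H = Graph (verts G \<union> verts H) (edges G \<union> edges H)"

definition join :: "'a graph \<Rightarrow> 'a graph \<Rightarrow> 'a graph" where
  "join G H = Graph (verts G \<union> verts H)
     (edges G \<union> edges H \<union> {{u, v} | u v. u \<in> verts G \<and> v \<in> verts H})"

inductive cograph :: "'a graph \<Rightarrow> bool" where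
  single: "cograph (Graph {v} {})"
| disjoint_union: "cograph G \<Longrightarrow> cograph H \<Longrightarrow> verts G \<inter> verts H = {} \<Longrightarrow> cograph (disjoint_union G H)"
| join: "cograph G \<Longrightarrow> cograph H \<Longrightarrow> verts G \<inter> verts H = {} \<Longrightarrow> cograph (join G H)"

definition edge_connectivity :: "'a graph \<Rightarrow> nat" where
  "edge_connectivity G = (LEAST n. \<exists>F \<subseteq> edges G. card F = n \<and>
     (\<not> connected_graph (delete_edges G F) \<or> card (verts (delete_edges G F)) = 1))"

text \<open>The one-vertex graph has edge-connectivity 0, but by convention it counts as
  1-edge-connected.\<close>

definition edge_connected :: "nat \<Rightarrow> 'a graph \<Rightarrow> bool" where
  "edge_connected k G \<longleftrightarrow> k \<le> edge_connectivity G \<or> (k = 1 \<and> card (verts G) = 1)"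

lemma simple_graph_if_cograph: "cograph G \<Longrightarrow> simple_graph G"
proof (induction rule: cograph.induct)
  case (join G H)
  have "card {u, v} = 2" if "u \<in> verts G" "v \<in> verts H" for u v
  proof -
    have "u \<noteq> v" using that join.hyps by auto
    then show ?thesis by simp
  qed
  with join.IH show ?case by (fastforce simp: simple_graph_def join_def)
qed (auto simp: simple_graph_def disjoint_union_def)

lemma edge_connectivity_single: "edge_connectivity (Graph {v} {}) = 0"
  by (simp add: edge_connectivity_def delete_edges_def)

end

theory Submission
  imports Defs
begin

text \<open>A connected cograph with at least two vertices is a join, so any two of its vertices are
  equal, adjacent or have a common neighbour. Hence (Plesnik) every edge cut has at least
  \<open>\<delta>(G) \<ge> k + m - 1\<close> edges. A copy of \<open>T\<close> can be embedded greedily, leaf by leaf, and as it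
  has only \<open>m - 1\<close> edges, deleting them leaves at least \<open>k\<close> edges in every cut.\<close>

section \<open>Edge cuts\<close>

definition edge_cut :: "'a graph \<Rightarrow> 'a set \<Rightarrow> 'a set set" where
  "edge_cut G S = {e \<in> edges G. \<exists>x \<in> S. \<exists>y \<in> verts G - S. e = {x, y}}"

lemma finite_edges:
  assumes "simple_graph G"
  shows "finite (edges G)"
proof (rule finite_subset)
  show "edges G \<subseteq> Pow (verts G)"
    using assms by (auto simp: simple_graph_def)
  show "finite (Pow (verts G))"
    using assms by (simp add: simple_graph_def)
qed

lemma adjacent_verts:
  assumes "simple_graph G" "adjacent G u v"
  shows "u \<in> verts G" "v \<in> verts G" "u \<noteq> v"
proof -
  have "{u, v} \<subseteq> verts G" "card {u, v} = 2"
    using assms by (auto simp: simple_graph_def)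
  then show "u \<in> verts G" "v \<in> verts G" "u \<noteq> v" by auto
qed

lemma min_degree_le_degree:
  assumes "simple_graph G" "v \<in> verts G"
  shows "min_degree G \<le> degree G v"
  using assms by (simp add: min_degree_def simple_graph_def)

lemma edge_cut_Diff:
  assumes "S \<subseteq> verts G"
  shows "edge_cut G (verts G - S) = edge_cut G S"
proof -
  have "verts G - (verts G - S) = S" using assms by blast
  then show ?thesis unfolding edge_cut_def by (auto simp: insert_commute)
qed

text \<open>Fix \<open>v\<close> in \<open>S\<close> and charge each neighbour \<open>w\<close> of
  \<open>v\<close> to a cut edge: to \<open>{v, w}\<close> if \<open>w\<close> lies outside
  \<open>S\<close>, otherwise to an edge from \<open>w\<close> to a chosen neighbour
  \<open>g w\<close> outside \<open>S\<close>. The charging is injective, so the cut has at least as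
  many edges as \<open>v\<close> has neighbours.\<close>

lemma min_degree_le_edge_cut_aux:
  assumes G: "simple_graph G" and S: "S \<subseteq> verts G" "S \<noteq> {}"
    and nbr: "\<And>x. x \<in> S \<Longrightarrow> \<exists>y \<in> verts G - S. adjacent G x y"
  shows "min_degree G \<le> card (edge_cut G S)"
proof -
  obtain v where v: "v \<in> S" using S by blast
  obtain g where g: "\<And>x. x \<in> S \<Longrightarrow> g x \<in> verts G - S \<and> adjacent G x (g x)"
    using nbr by metis
  define N where "N = {w \<in> verts G. adjacent G v w}"
  define h where "h w = (if w \<in> S then {w, g w} else {v, w})" for w
  have ne: "w \<noteq> v" if "w \<in> N" for w
    using that adjacent_verts(3)[OF G, of v w] by (simp add: N_def)
  \<comment> \<open>The end of \<open>h w\<close> inside \<open>S\<close> is \<open>w\<close> if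
    \<open>w\<close> is in \<open>S\<close>, and \<open>v\<close> otherwise. As \<open>w\<close>
    differs from \<open>v\<close>, the two kinds of edges never coincide, and within each kind the
    edge determines \<open>w\<close>.\<close>
  have "inj_on h N"
  proof (rule inj_onI)
    fix w w' assume "w \<in> N" "w' \<in> N" "h w = h w'"
    then show "w = w'"
      using ne[of w] ne[of w'] g[of w] g[of w'] v
      by (auto simp: h_def doubleton_eq_iff split: if_splits)
  qed
  moreover have "h ` N \<subseteq> edge_cut G S"
    using g v by (fastforce simp: h_def N_def edge_cut_def)
  moreover have "finite (edge_cut G S)"
    using finite_edges[OF G] by (simp add: edge_cut_def)
  ultimately have "card N \<le> card (edge_cut G S)" by (rule card_inj_on_le)
  then show ?thesis
    using min_degree_le_degree[OF G, of v] v S by (auto simp: degree_def N_def)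
qed

text \<open>On one of the two sides every vertex has a neighbour across. If some \<open>x\<close> in
  \<open>S\<close> has none, then each \<open>y\<close> outside \<open>S\<close> shares a neighbour
  with \<open>x\<close>, and that neighbour is forced into \<open>S\<close>. The counting then
  applies to the complement, which has the same cut.\<close>

lemma min_degree_le_edge_cut:
  assumes G: "simple_graph G" and S: "S \<subseteq> verts G" "S \<noteq> {}" "S \<noteq> verts G"
    and diam: "\<And>x y. x \<in> verts G \<Longrightarrow> y \<in> verts G \<Longrightarrow> x \<noteq> y \<Longrightarrow> \<not> adjacent G x y \<Longrightarrow>
      \<exists>z \<in> verts G. adjacent G x z \<and> adjacent G z y"
  shows "min_degree G \<le> card (edge_cut G S)"
proof (cases "\<forall>x \<in> S. \<exists>y \<in> verts G - S. adjacent G x y")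
  case True
  then show ?thesis using min_degree_le_edge_cut_aux[OF G S(1,2)] by blast
next
  case False
  then obtain x where x: "x \<in> S" "\<And>y. y \<in> verts G - S \<Longrightarrow> \<not> adjacent G x y" by blast
  have "\<exists>z \<in> verts G - (verts G - S). adjacent G y z" if y: "y \<in> verts G - S" for y
  proof -
    obtain z where z: "z \<in> verts G" "adjacent G x z" "adjacent G z y"
      using diam[of x y] x y S by auto
    then have "z \<in> S" using x by blast
    then show ?thesis using z by (auto simp: insert_commute)
  qed
  then have "min_degree G \<le> card (edge_cut G (verts G - S))"
    using min_degree_le_edge_cut_aux[OF G, of "verts G - S"] S by blast
  then show ?thesis using edge_cut_Diff S by metis
qed

text \<open>Take for \<open>S\<close> the vertices reachable from some \<open>u\<close> once
  \<open>F\<close> is deleted, where \<open>u\<close> fails to reach some \<open>v\<close>. An edge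
  leaving \<open>S\<close> outside \<open>F\<close> would make its far end reachable too.\<close>

lemma not_connected_graphE:
  assumes "simple_graph G" "\<not> connected_graph (delete_edges G F)"
  obtains S where "S \<subseteq> verts G" "S \<noteq> {}" "S \<noteq> verts G" "edge_cut G S \<subseteq> F"
proof -
  let ?R = "adjacent (delete_edges G F)"
  obtain u v where uv: "u \<in> verts G" "v \<in> verts G" "\<not> ?R\<^sup>*\<^sup>* u v"
    using assms by (auto simp: connected_graph_def delete_edges_def simple_graph_def)
  let ?S = "{w \<in> verts G. ?R\<^sup>*\<^sup>* u w}"
  have "edge_cut G ?S \<subseteq> F"
  proof
    fix e assume "e \<in> edge_cut G ?S"
    then obtain x y where e: "e \<in> edges G" "e = {x, y}" "?R\<^sup>*\<^sup>* u x" "y \<in> verts G" "\<not> ?R\<^sup>*\<^sup>* u y"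
      by (auto simp: edge_cut_def)
    then have "\<not> ?R x y" by (meson rtranclp.rtrancl_into_rtrancl)
    then show "e \<in> F" using e by (simp add: delete_edges_def)
  qed
  moreover have "u \<in> ?S" "v \<notin> ?S" using uv by auto
  ultimately show thesis using that[of ?S] uv by blast
qed

lemma connected_edge_leaving:
  assumes G: "simple_graph G" "connected_graph G" and S: "S \<subseteq> verts G" "S \<noteq> {}" "S \<noteq> verts G"
  obtains u v where "u \<in> S" "v \<in> verts G - S" "adjacent G u v"
proof -
  obtain a b where ab: "a \<in> S" "b \<in> verts G" "b \<notin> S" using S by blast
  then have "(adjacent G)\<^sup>*\<^sup>* a b" using G S by (auto simp: connected_graph_def)
  \<comment> \<open>If no edge left \<open>S\<close>, induction along the walk from \<open>a\<close>
    would keep it inside \<open>S\<close> up to \<open>b\<close>.\<close>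
  then have "b \<in> S" if "\<And>u v. u \<in> S \<Longrightarrow> adjacent G u v \<Longrightarrow> v \<in> S"
    using ab(1) by (induction rule: rtranclp_induct) (use that in blast)+
  then show thesis using that ab adjacent_verts[OF G(1)] by blast
qed

text \<open>Only the last construction step of the cograph matters. A disjoint union is excluded,
  because no edge leaves \<open>verts A\<close>. In a join, nonadjacent vertices lie on the same
  side, and any vertex of the other side is a common neighbour.\<close>

lemma connected_cograph_diameter:
  assumes "cograph G" "connected_graph G" "x \<in> verts G" "y \<in> verts G" "x \<noteq> y" "\<not> adjacent G x y"
  shows "\<exists>z \<in> verts G. adjacent G x z \<and> adjacent G z y"
  using assms(1)
proof cases
  case (single v)
  then show ?thesis using assms by auto
next
  case (disjoint_union A B)
  note simple = disjoint_union(2,3)[THEN simple_graph_if_cograph]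
  have "simple_graph G" using assms(1) by (rule simple_graph_if_cograph)
  moreover have "verts A \<subseteq> verts G" "verts A \<noteq> {}" "verts A \<noteq> verts G"
    using disjoint_union simple by (auto simp: simple_graph_def disjoint_union_def)
  ultimately obtain u v where "u \<in> verts A" "v \<in> verts G - verts A" "adjacent G u v"
    using connected_edge_leaving assms(2) by metis
  then show ?thesis
    using disjoint_union simple[THEN adjacent_verts(1), of u v] simple[THEN adjacent_verts(2), of u v]
    by (auto simp: disjoint_union_def)
next
  case (join A B)
  have adj: "adjacent G a b" "adjacent G b a" if "a \<in> verts A" "b \<in> verts B" for a b
    using that join by (auto simp: join_def insert_commute)
  obtain a b where ab: "a \<in> verts A" "b \<in> verts B"
    using join(2,3)[THEN simple_graph_if_cograph] by (auto simp: simple_graph_def)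
  have V: "verts G = verts A \<union> verts B" using join by (simp add: join_def)
  consider "x \<in> verts A" "y \<in> verts A" | "x \<in> verts B" "y \<in> verts B"
    using assms V adj by blast
  then show ?thesis using ab adj V by cases blast+
qed

section \<open>Growing trees\<close>

definition is_path :: "'a graph \<Rightarrow> 'a list \<Rightarrow> bool" where
  "is_path G p \<longleftrightarrow> p \<noteq> [] \<and> distinct p \<and> set p \<subseteq> verts G \<and> successively (adjacent G) p"

text \<open>This turns two distinct neighbours of \<open>v\<close>, joined by a path avoiding
  \<open>v\<close>, into a contradiction with acyclicity. Distinct ends give \<open>p\<close> at
  least two vertices, hence the cycle at least three.\<close>

lemma is_cycle_Cons:
  assumes p: "is_path G p" "hd p \<noteq> last p" and v: "v \<in> verts G" "v \<notin> set p"
    and adj: "adjacent G v (hd p)" "adjacent G (last p) v"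
  shows "is_cycle G (v # p)"
proof -
  have len: "length p \<ge> 2"
    using p by (cases p; cases "tl p") (auto simp: is_path_def)
  have "adjacent G ((v # p) ! i) ((v # p) ! (Suc i mod length (v # p)))" if i: "i < length (v # p)" for i
  proof -
    \<comment> \<open>The cases are the edge from \<open>v\<close> into \<open>p\<close>, an edge of
      \<open>p\<close>, and the closing edge, whose successor index wraps around to
      \<open>v\<close>.\<close>
    consider "i = 0" | j where "i = Suc j" "Suc j < length p" | "i = length p"
      using i by (cases i) (auto simp: less_Suc_eq)
    then show ?thesis
    proof cases
      case 1
      then show ?thesis using adj len by (simp add: hd_conv_nth flip: length_greater_0_conv)
    next
      case 2
      then show ?thesis using p by (simp add: is_path_def successively_conv_nth)
    next
      case 3
      then have "(v # p) ! i = last p"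
        using len by (cases p rule: rev_cases) (simp_all add: nth_append)
      then show ?thesis using adj 3 by simp
    qed
  qed
  then show ?thesis using p v len by (auto simp: is_cycle_def is_path_def)
qed

definition induced :: "'a graph \<Rightarrow> 'a set \<Rightarrow> 'a graph" where
  "induced G S = Graph S {e \<in> edges G. e \<subseteq> S}"

text \<open>The tree is built upwards inside \<open>T\<close> by growing \<open>S\<close> until it
  is all of \<open>verts T\<close>, so no leaf of a given tree has to be found. The induction
  carries explicit paths inside \<open>S\<close>, since these avoid the new vertex and can be closed
  to a cycle through it.\<close>

lemma tree_induct [consumes 1, case_names single leaf]:
  assumes T: "is_tree T"
    and single: "\<And>v. P (Graph {v} {})"
    and leaf: "\<And>H u v. simple_graph H \<Longrightarrow> u \<in> verts H \<Longrightarrow> v \<notin> verts H \<Longrightarrow> P H \<Longrightarrow>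
      P (Graph (insert v (verts H)) (insert {u, v} (edges H)))"
  shows "P T"
proof -
  have simple: "simple_graph T" and conn: "connected_graph T" and acyc: "\<And>c. \<not> is_cycle T c"
    using T by (auto simp: is_tree_def)
  have edge: "e \<subseteq> verts T" "card e = 2" if "e \<in> edges T" for e
    using simple that by (auto simp: simple_graph_def)
  have fin: "finite (verts T)" "verts T \<noteq> {}" using simple by (auto simp: simple_graph_def)
  \<comment> \<open>A connected proper subset of the vertices extends by a vertex with exactly one neighbour
    in it: two neighbours would close a cycle.\<close>
  have "\<exists>S. S \<subseteq> verts T \<and> card S = Suc n \<and> P (induced T S) \<and>
      (\<forall>x \<in> S. \<forall>y \<in> S. \<exists>p. is_path T p \<and> set p \<subseteq> S \<and> hd p = x \<and> last p = y)"
    if "Suc n \<le> card (verts T)" for n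
    using that
  proof (induction n)
    case 0
    obtain r where r: "r \<in> verts T" using fin by blast
    have "e = {}" if "e \<in> edges T" "e \<subseteq> {r}" for e
      using edge[of e] that by (auto simp: subset_singleton_iff)
    then have "{e \<in> edges T. e \<subseteq> {r}} = {}" using edge by fastforce
    then have "P (induced T {r})" using single by (simp only: induced_def)
    moreover have "is_path T [r]" using r by (simp add: is_path_def)
    ultimately show ?case using r by (intro exI[of _ "{r}"]) force
  next
    case (Suc n)
    then obtain S where S: "S \<subseteq> verts T" "card S = Suc n" "P (induced T S)"
      and path: "\<And>x y. x \<in> S \<Longrightarrow> y \<in> S \<Longrightarrow> \<exists>p. is_path T p \<and> set p \<subseteq> S \<and> hd p = x \<and> last p = y"
      by (metis Suc_leD)
    have finS: "finite S" and neS: "S \<noteq> {}" using S by (auto intro: card_ge_0_finite)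
    have "S \<noteq> verts T" using S Suc.prems by auto
    then obtain u v where uv: "u \<in> S" "v \<in> verts T" "v \<notin> S" "adjacent T u v"
      using connected_edge_leaving[OF simple conn S(1) neS] by blast
    have vu: "adjacent T v u" using uv by (simp add: insert_commute)
    have uniq: "w = u" if w: "w \<in> S" "adjacent T v w" for w
    proof (rule ccontr)
      assume "w \<noteq> u"
      moreover obtain p where "is_path T p" "set p \<subseteq> S" "hd p = w" "last p = u"
        using path[OF w(1) uv(1)] by blast
      ultimately show False using is_cycle_Cons[of T p v] acyc uv w by auto
    qed
    \<comment> \<open>By \<open>uniq\<close>, passing from \<open>S\<close> to
      \<open>insert v S\<close> adds exactly one edge to the induced graph, which is the form that
      \<open>leaf\<close> expects.\<close>
    have "e = {u, v}" if e: "e \<in> edges T" "e \<subseteq> insert v S" "v \<in> e" for e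
    proof -
      obtain w where "e = {v, w}" "w \<noteq> v"
        using edge(2)[OF e(1)] e(3) by (auto simp: card_2_iff)
      then show ?thesis using uniq[of w] e by (auto simp: insert_commute)
    qed
    then have "{e \<in> edges T. e \<subseteq> insert v S} = insert {u, v} {e \<in> edges T. e \<subseteq> S}"
      using uv by blast
    then have "induced T (insert v S) =
        Graph (insert v (verts (induced T S))) (insert {u, v} (edges (induced T S)))"
      by (simp add: induced_def)
    moreover have "simple_graph (induced T S)"
      using edge finS neS by (auto simp: simple_graph_def induced_def)
    ultimately have "P (induced T (insert v S))"
      using leaf[of "induced T S" u v] S uv by (simp add: induced_def)
    \<comment> \<open>Paths ending at the new vertex \<open>v\<close> extend paths inside
      \<open>S\<close> that end at its neighbour \<open>u\<close>.\<close>
    moreover have "\<exists>p. is_path T p \<and> set p \<subseteq> insert v S \<and> hd p = x \<and> last p = y"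
      if xy: "x \<in> insert v S" "y \<in> insert v S" for x y
    proof -
      consider "x \<in> S" "y \<in> S" | "x = v" "y = v" | "x = v" "y \<in> S" | "x \<in> S" "y = v"
        using xy by blast
      then show ?thesis
      proof cases
        case 1
        then show ?thesis using path by blast
      next
        case 2
        then show ?thesis using uv by (intro exI[of _ "[v]"]) (simp add: is_path_def)
      next
        case 3
        then obtain p where "is_path T p" "set p \<subseteq> S" "hd p = u" "last p = y"
          using path uv by blast
        then show ?thesis using 3 uv vu
          by (intro exI[of _ "v # p"]) (auto simp: is_path_def successively_Cons)
      next
        case 4
        then obtain p where "is_path T p" "set p \<subseteq> S" "hd p = x" "last p = u"
          using path uv by blast
        then show ?thesis using 4 uv
          by (intro exI[of _ "p @ [v]"]) (auto simp: is_path_def successively_append_iff)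
      qed
    qed
    ultimately show ?case using S uv finS by (intro exI[of _ "insert v S"]) simp
  qed
  \<comment> \<open>This choice of \<open>n\<close> makes \<open>S\<close> as large as
    \<open>verts T\<close>; the subtraction is exact because \<open>T\<close> has a vertex.\<close>
  from this[of "card (verts T) - 1"]
  obtain S where "S \<subseteq> verts T" "card S = card (verts T)" "P (induced T S)"
    using fin by (auto simp: card_gt_0_iff Suc_le_eq)
  then have "P (induced T (verts T))" using card_subset_eq fin by metis
  moreover have "induced T (verts T) = T"
    using edge by (cases T) (auto simp: induced_def)
  ultimately show ?thesis by simp
qed

text \<open>Each new leaf brings at most one edge. This bounds the number of edges that deleting a
  copy of the tree can cost a cut.\<close>

lemma card_edges_tree_le:
  assumes "is_tree T"
  shows "card (edges T) \<le> card (verts T) - 1"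
  using assms
proof (induction rule: tree_induct)
  case (leaf H u v)
  \<comment> \<open>A nonempty \<open>H\<close> keeps the truncated subtraction exact.\<close>
  then have "card (verts H) > 0" by (auto simp: simple_graph_def card_gt_0_iff)
  moreover have "card (insert {u, v} (edges H)) \<le> Suc (card (edges H))"
    by (rule card_insert_le_m1) simp_all
  ultimately show ?case using leaf by (simp add: simple_graph_def)
qed simp

text \<open>When a leaf \<open>v\<close> at \<open>u\<close> is to be placed, fewer than
  \<open>min_degree G\<close> vertices are occupied, while \<open>f u\<close> has at least that many
  neighbours. A free neighbour \<open>w\<close> therefore exists and serves as the image of
  \<open>v\<close>.\<close>

lemma greedy_tree_embedding:
  assumes "is_tree T" and G: "simple_graph G" and "card (verts T) \<le> min_degree G"
  shows "\<exists>f. inj_on f (verts T) \<and> f ` verts T \<subseteq> verts G \<and> (\<lambda>e. f ` e) ` edges T \<subseteq> edges G"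
  using assms(1,3)
proof (induction rule: tree_induct)
  case (single v)
  obtain r where "r \<in> verts G" using G by (auto simp: simple_graph_def)
  then show ?case by (intro exI[of _ "\<lambda>_. r"]) simp
next
  case (leaf H u v)
  have fin: "finite (verts H)" using leaf by (simp add: simple_graph_def)
  then have card: "card (verts H) < min_degree G" using leaf by simp
  then obtain f where f: "inj_on f (verts H)" "f ` verts H \<subseteq> verts G" "(\<lambda>e. f ` e) ` edges H \<subseteq> edges G"
    using leaf by auto
  let ?N = "{w \<in> verts G. adjacent G (f u) w}"
  have "card (f ` verts H) < card ?N"
    using card f leaf min_degree_le_degree[OF G, of "f u"] by (auto simp: card_image degree_def)
  then have "\<not> ?N \<subseteq> f ` verts H" using card_mono[of "f ` verts H" ?N] fin by auto
  then obtain w where w: "w \<in> verts G" "adjacent G (f u) w" "w \<notin> f ` verts H" by blast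
  define g where "g = f(v := w)"
  have eq: "g x = f x" if "x \<in> verts H" for x using that leaf by (auto simp: g_def)
  have gv: "g v = w" by (simp add: g_def)
  \<comment> \<open>Since \<open>v\<close> is new, the update leaves the image of every old edge
    unchanged.\<close>
  have "g ` e = f ` e" if "e \<in> edges H" for e
    using leaf that by (intro image_cong refl eq) (auto simp: simple_graph_def)
  then have "(\<lambda>e. g ` e) ` edges H \<subseteq> edges G" using f by auto
  moreover have "g ` {u, v} = {f u, w}" using eq gv leaf by auto
  moreover have "g ` verts H = f ` verts H" by (intro image_cong refl eq)
  moreover have "inj_on g (verts H)" using f eq by (simp cong: inj_on_cong)
  ultimately show ?case using w f leaf gv by (intro exI[of _ g]) simp
qed

section \<open>Isomorphic copies of trees\<close>

text \<open>Injectivity makes adjacency transfer in both directions. Walks are then pushed forward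
  along \<open>f\<close> to give connectedness, and a cycle in the image is pulled back by the
  inverse to a cycle in \<open>T\<close>.\<close>

lemma is_tree_image:
  assumes T: "is_tree T" and f: "inj_on f (verts T)"
  defines "T' \<equiv> Graph (f ` verts T) ((\<lambda>e. f ` e) ` edges T)"
  shows "is_tree T'" "graph_isomorphic T' T"
proof -
  have simple: "simple_graph T" and conn: "connected_graph T" and acyc: "\<And>c. \<not> is_cycle T c"
    using T by (auto simp: is_tree_def)
  have edge: "e \<subseteq> verts T" "card e = 2" if "e \<in> edges T" for e
    using simple that by (auto simp: simple_graph_def)
  have adj: "adjacent T' (f x) (f y) \<longleftrightarrow> adjacent T x y" if "x \<in> verts T" "y \<in> verts T" for x y
  proof
    assume "adjacent T' (f x) (f y)"
    then obtain e where e: "e \<in> edges T" "f ` {x, y} = f ` e" by (auto simp: T'_def)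
    then have "{x, y} = e" using inj_on_image_eq_iff[OF f, of "{x, y}" e] edge that by auto
    then show "adjacent T x y" using e by simp
  next
    assume "adjacent T x y"
    then have "f ` {x, y} \<in> edges T'" by (simp only: T'_def graph.sel imageI)
    then show "adjacent T' (f x) (f y)" by simp
  qed
  let ?h = "the_inv_into (verts T) f"
  have h: "?h (f x) = x" if "x \<in> verts T" for x using f that by (rule the_inv_into_f_f)
  have V: "verts T' = f ` verts T" by (simp add: T'_def)
  have bij: "bij_betw ?h (verts T') (verts T)"
    unfolding V using f by (intro bij_betw_the_inv_into) (simp add: bij_betw_def)
  show "graph_isomorphic T' T"
    unfolding graph_isomorphic_def
  proof (intro exI[of _ ?h] conjI ballI)
    fix a b assume "a \<in> verts T'" "b \<in> verts T'"
    then obtain x y where "x \<in> verts T" "y \<in> verts T" "a = f x" "b = f y" unfolding V by blast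
    then show "adjacent T' a b \<longleftrightarrow> adjacent T (?h a) (?h b)" using adj h by simp
  qed (rule bij)
  have "simple_graph T'"
    using simple edge f by (auto simp: T'_def simple_graph_def card_image inj_on_subset)
  moreover have "connected_graph T'"
    unfolding connected_graph_def
  proof (intro conjI ballI)
    show "verts T' \<noteq> {}" using simple by (simp add: V simple_graph_def)
    fix a b assume "a \<in> verts T'" "b \<in> verts T'"
    then obtain x y where xy: "x \<in> verts T" "y \<in> verts T" "a = f x" "b = f y" by (auto simp: V)
    then have "(adjacent T)\<^sup>*\<^sup>* x y" using conn by (simp add: connected_graph_def)
    then have "(adjacent T')\<^sup>*\<^sup>* (f x) (f y)"
    proof (induction rule: rtranclp_induct)
      case (step y z)
      then have "adjacent T' (f y) (f z)" using adj adjacent_verts[OF simple] by simp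
      then show ?case using step.IH by (rule rtranclp.rtrancl_into_rtrancl[rotated])
    qed simp
    then show "(adjacent T')\<^sup>*\<^sup>* a b" using xy by simp
  qed
  moreover have False if c: "is_cycle T' c" for c
  proof -
    have set: "set c \<subseteq> f ` verts T" using c by (simp add: is_cycle_def V)
    have "adjacent T (map ?h c ! i) (map ?h c ! (Suc i mod length c))" if i: "i < length c" for i
    proof -
      \<comment> \<open>The wrapped successor index also stays within \<open>c\<close>, so both ends
        of the edge have preimages in \<open>T\<close>.\<close>
      have j: "Suc i mod length c < length c" using i by (intro mod_less_divisor) linarith
      obtain x y where xy: "x \<in> verts T" "y \<in> verts T" "c ! i = f x" "c ! (Suc i mod length c) = f y"
        using set nth_mem[OF i] nth_mem[OF j] by blast
      have "adjacent T' (f x) (f y)" using c i xy by (auto simp: is_cycle_def)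
      then show ?thesis using xy adj h i j by simp
    qed
    moreover have "distinct (map ?h c)"
      using c bij by (auto simp: is_cycle_def distinct_map bij_betw_def inj_on_subset)
    moreover have "set (map ?h c) \<subseteq> verts T" using set h by auto
    ultimately have "is_cycle T (map ?h c)" using c by (simp add: is_cycle_def)
    then show False using acyc by blast
  qed
  ultimately show "is_tree T'" by (auto simp: is_tree_def)
qed

section \<open>Edge-connectivity of cographs\<close>

text \<open>The \<open>LEAST\<close> is a true minimum because some set qualifies: deleting all
  edges leaves a disconnected graph unless there is just one vertex.\<close>

lemma edge_connectivity_attained:
  assumes "simple_graph G"
  obtains F where "F \<subseteq> edges G" "card F = edge_connectivity G"
    "\<not> connected_graph (delete_edges G F) \<or> card (verts G) = 1"
proof -
  let ?Q = "\<lambda>n. \<exists>F \<subseteq> edges G. card F = n \<and>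
     (\<not> connected_graph (delete_edges G F) \<or> card (verts (delete_edges G F)) = 1)"
  have "card (verts G) = 1" if "connected_graph (delete_edges G (edges G))"
  proof -
    obtain r where r: "r \<in> verts G" using assms by (auto simp: simple_graph_def)
    have "v = r" if "v \<in> verts G" for v
    proof -
      have "(adjacent (delete_edges G (edges G)))\<^sup>*\<^sup>* r v"
        using \<open>connected_graph (delete_edges G (edges G))\<close> r that
        by (simp add: connected_graph_def delete_edges_def)
      then show ?thesis by cases (simp_all add: delete_edges_def)
    qed
    then have "verts G = {r}" using r by blast
    then show ?thesis by simp
  qed
  then have "?Q (card (edges G))"
    by (intro exI[of _ "edges G"]) (auto simp: delete_edges_def)
  then have "?Q (LEAST n. ?Q n)" by (rule LeastI)
  then obtain F where "F \<subseteq> edges G" "card F = edge_connectivity G"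
    "\<not> connected_graph (delete_edges G F) \<or> card (verts (delete_edges G F)) = 1"
    unfolding edge_connectivity_def by blast
  then show thesis using that[of F] by (simp add: delete_edges_def)
qed

text \<open>For a disconnected graph the empty set of edges already qualifies, which makes the
  minimum 0.\<close>

lemma connected_if_edge_connectivity_pos:
  assumes "edge_connectivity G > 0"
  shows "connected_graph G"
proof (rule ccontr)
  assume "\<not> connected_graph G"
  then have "\<not> connected_graph (delete_edges G {})" by (cases G) (simp add: delete_edges_def)
  then have "edge_connectivity G \<le> 0"
    unfolding edge_connectivity_def by (intro Least_le exI[of _ "{}"]) simp
  then show False using assms by simp
qed

text \<open>A minimum disconnecting set \<open>F'\<close> of the remaining graph disconnects
  \<open>G\<close> together with \<open>F\<close>. Hence the union of \<open>F\<close> and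
  \<open>F'\<close> contains an edge cut of \<open>G\<close>, which has at least
  \<open>min_degree G\<close> edges.\<close>

lemma min_degree_le_edge_connectivity_delete:
  assumes "cograph G" "connected_graph G" "card (verts G) \<noteq> 1" "F \<subseteq> edges G"
  shows "min_degree G \<le> card F + edge_connectivity (delete_edges G F)"
proof -
  have G: "simple_graph G" using assms(1) by (rule simple_graph_if_cograph)
  then have "simple_graph (delete_edges G F)" by (simp add: simple_graph_def delete_edges_def)
  then obtain F' where F': "F' \<subseteq> edges G - F" "card F' = edge_connectivity (delete_edges G F)"
    "\<not> connected_graph (delete_edges (delete_edges G F) F')"
    using assms(3) edge_connectivity_attained[of "delete_edges G F"]
    by (metis delete_edges_def graph.sel)
  moreover have "delete_edges (delete_edges G F) F' = delete_edges G (F \<union> F')"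
    by (auto simp: delete_edges_def)
  ultimately obtain S where S: "S \<subseteq> verts G" "S \<noteq> {}" "S \<noteq> verts G" "edge_cut G S \<subseteq> F \<union> F'"
    using not_connected_graphE[OF G, of "F \<union> F'"] by auto
  have "min_degree G \<le> card (edge_cut G S)"
    using min_degree_le_edge_cut[OF G S(1-3)] connected_cograph_diameter[OF assms(1,2)] by blast
  also have "\<dots> \<le> card (F \<union> F')"
    using S(4) F'(1) assms(4) finite_edges[OF G] by (intro card_mono) (auto intro: finite_subset)
  also have "\<dots> \<le> card F + card F'" by (rule card_Un_le)
  finally show ?thesis using F' by simp
qed

theorem corollary9:
  fixes k m :: nat and T :: "'b graph" and G :: "'a graph"
  assumes "k \<ge> 1" and "m \<ge> 1"
    and "is_tree T" and "card (verts T) = m"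
    and "cograph G" and "edge_connected k G"
    and "min_degree G \<ge> k + m - 1"
  shows "\<exists>T'. subgraph T' G \<and> is_tree T' \<and> graph_isomorphic T' T \<and>
           edge_connected k (delete_edges G (edges T'))"
proof -
  have G: "simple_graph G" using assms(5) by (rule simple_graph_if_cograph)
  \<comment> \<open>The single vertex has degree 0, but k + m - 1 is at least 1. This rules out the
    convention for \<open>K_1\<close>, so edge-connectedness of \<open>G\<close> means a genuine
    bound on \<open>edge_connectivity G\<close>.\<close>
  have order: "card (verts G) \<noteq> 1"
  proof
    assume "card (verts G) = 1"
    then obtain r where r: "verts G = {r}" by (auto simp: card_1_singleton_iff)
    then have "{u \<in> verts G. adjacent G r u} = {}" using adjacent_verts(3)[OF G, of r r] by auto
    then have "degree G r = 0" by (simp only: degree_def card.empty)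
    then show False using min_degree_le_degree[OF G, of r] r assms by simp
  qed
  then have conn: "connected_graph G"
    using assms by (intro connected_if_edge_connectivity_pos) (auto simp: edge_connected_def)
  \<comment> \<open>As k is at least 1, the bound k + m - 1 is at least m.\<close>
  have "card (verts T) \<le> min_degree G" using assms by linarith
  then obtain f where f: "inj_on f (verts T)" "f ` verts T \<subseteq> verts G"
    "(\<lambda>e. f ` e) ` edges T \<subseteq> edges G"
    using greedy_tree_embedding[OF assms(3) G] by blast
  define T' where "T' = Graph (f ` verts T) ((\<lambda>e. f ` e) ` edges T)"
  have tree: "is_tree T'" and iso: "graph_isomorphic T' T"
    using is_tree_image[OF assms(3) f(1)] by (simp_all add: T'_def)
  have sub: "subgraph T' G" using tree f by (simp add: subgraph_def is_tree_def T'_def)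
  have "card (edges T') \<le> m - 1"
    using card_edges_tree_le[OF tree] f(1) assms(4) by (simp add: T'_def card_image)
  moreover have "min_degree G \<le> card (edges T') + edge_connectivity (delete_edges G (edges T'))"
    using sub by (intro min_degree_le_edge_connectivity_delete assms conn order) (simp add: subgraph_def)
  \<comment> \<open>With L the edge-connectivity after the deletion, k + m - 1 <= (m - 1) + L, and m
    - 1 cancels as m is at least 1.\<close>
  ultimately have "k \<le> edge_connectivity (delete_edges G (edges T'))"
    using assms(1,2,7) by linarith
  then have "edge_connected k (delete_edges G (edges T'))"
    unfolding edge_connected_def by blast
  then show ?thesis using tree iso sub by blast
qed

end
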